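(* Let $R$ be a $\lambda_e$-strong hyperring (with $e\in R$) and let $M$ be a non-empty subset of $R$. Then: (i) $M\cdot D_e(R)=D_e(R)\cdot M=\phi_e^{-1}(\phi_e(M))$; (ii) $M$ is a $\lambda_e$-part of $R$ if and only if $\phi_e^{-1}(\phi_e(M))=M$.
   Context: A hyperoperation on a non-empty set $H$ is a map $\circ$ from $H\times H$ to the non-empty subsets of $H$; for non-empty $A,B\subseteq H$, $A\circ B=\bigcup_{a\in A,b\in B}a\circ b$, and elements are identified with singletons. $(H,\circ)$ is a semi-hypergroup if $x\circ(y\circ z)=(x\circ y)\circ z$ for all $x,y,z$, and a hypergroup if moreover $x\circ H=H\circ x=H$ for all $x\in H$. A hyperring $(R,+,\cdot)$ consists of a hypergroup $(R,+)$ (not assumed commutative) and a semi-hypergroup $(R,\cdot)$ (no unit assumed, not assumed commutative) such that $x\cdot(y+z)=x\cdot y+x\cdot z$ and $(x+y)\cdot z=x\cdot z+y\cdot z$ for all $x,y,z\in R$. For $n\in\mathbb{N}=\{1,2,\dots\}$, $k_i\in\mathbb{N}$ and $x_{ij}\in R$, $\sum_{i=1}^{n}\prod_{j=1}^{k_i}x_{ij}$ denotes the subset of $R$ obtained by the iterated hyperoperations, in the indicated order (a product with one factor $x$ is $\{x\}$). $S_n$ is the symmetric group on $\{1,\dots,n\}$. $x\,\alpha_{+}\,y$ iff there exist $n\in\mathbb{N}$, $(k_1,\dots,k_n)\in\mathbb{N}^n$, $\sigma\in S_n$ and elements $x_{ij}\in R$ such that $x\in\sum_{i=1}^n\prod_{j=1}^{k_i}x_{ij}$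 and $y\in\sum_{i=1}^n A_{\sigma(i)}$, where $A_i=\prod_{j=1}^{k_i}x_{ij}$. Condition $\mathfrak{P}_e$: a pair of expressions $\big(\sum_{i=1}^m\prod_{j=1}^{k_i}x_{ij},\ \sum_{i=1}^m\prod_{t=1}^{k'_i}y_{it}\big)$ satisfies $\mathfrak{P}_e$ if one of the following holds: (1) $k_i=k'_i$ and $x_{ij}=y_{ij}$ for all $i,j$; (2) there exist $i_1,\dots,i_d\in\{1,\dots,m\}$ such that for every $i\notin\{i_1,\dots,i_d\}$ one has $k_i=k'_i$ and $x_{it}=y_{it}$ for all $1\le t\le k'_i$, and for every $i\in\{i_1,\dots,i_d\}$ there are $p_i,l_i\in\mathbb{N}$ with $1\le p_i\le l_i\le k'_i$ and $k'_i=k_i+(l_i-p_i+1)$ such that $y_{it}=x_{it}$ if $1\le t<p_i$, $y_{it}=e$ if $p_i\le t\le l_i$, and $y_{it}=x_{i\,(t+p_i-l_i-1)}$ if $l_i<t\le k'_i$ (i.e. a block of consecutive $e$'s is inserted in the $i$-th product). For $m\ge1$, $\Re_e^m$ is the set of all pairs $(A,B)$ and $(B,A)$ where $A=\sum_{i=1}^m\prod_{j=1}^{k_i}x_{ij}$, $B=\sum_{i=1}^m\prod_{t=1}^{k'_i}y_{it}$ and the pair $(A,B)$ satisfies $\mathfrak{P}_e$. Define $x\,(\lambda^e_\times)_m\,y$ iff there is $(A,B)\in\Re_e^m$ with $x\in A$, $y\in B$; $\lambda^e_\times=\bigcup_{m\ge1}(\lambda^e_\times)_m$; and $\lambda_e=\lambda^e_\times\cup\alpha_+$.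 $\lambda_e^{*}$ is the transitive closure of $\lambda_e$ (an equivalence relation), and $\lambda_e^*(a)$ is the class of $a$. The quotient $R/\lambda_e^*$ is a ring with identity $\lambda_e^*(e)$ under $\lambda_e^{*}(a)\oplus\lambda_e^{*}(b)=\lambda_e^{*}(c)$ for $c\in\lambda_e^*(a)+\lambda_e^*(b)$ and $\lambda_e^{*}(a)\otimes\lambda_e^{*}(b)=\lambda_e^{*}(d)$ for $d\in\lambda_e^*(a)\cdot\lambda_e^*(b)$. $\phi_e:R\to R/\lambda_e^*$ is the canonical projection and $D_e(R)=\phi_e^{-1}(1_{R/\lambda_e^*})$. A non-empty $M\subseteq R$ is a $\lambda_e$-part if: (P1) for all $n$, $k_1,\dots,k_n\in\mathbb{N}$, $x_{ij}\in R$ and $\sigma\in S_n$, $\sum_{i=1}^n\prod_{j=1}^{k_i}x_{ij}\cap M\ne\emptyset$ implies $\sum_{i=1}^n\prod_{j=1}^{k_{\sigma(i)}}x_{\sigma(i)j}\subseteq M$; and (P2) for all $m$, $k_i$, $x_{ij}$, $\sum_{i=1}^m\prod_{j=1}^{k_i}x_{ij}\cap M\ne\emptyset$ implies $\sum_{i=1}^m\prod_{t=1}^{k'_i}y_{it}\subseteq M$ whenever the pair $\big(\sum_{i=1}^m\prod_{j=1}^{k_i}x_{ij},\sum_{i=1}^m\prod_{t=1}^{k'_i}y_{it}\big)$ satisfies $\mathfrak{P}_e$. $R$ is $\lambda_e$-strong if: (i) for all $x,y\in R$, $x\,\lambda_e^*\,y$ implies $x\cdot e\cap y\cdot e\neq\emptyset$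 and $e\cdot x\cap e\cdot y\ne\emptyset$; (ii) $\{e\}$ is invertible in the semi-hypergroup $(R,\cdot)$, i.e. for all $x,y\in R$, $y\in x\cdot e$ implies $x\in y\cdot e$, and $y\in e\cdot x$ implies $x\in e\cdot y$. *)

theory Defs
  imports "HOL-Algebra.Ring" "HOL-Combinatorics.Permutations"
begin

section \<open>Hypergroups and hyperrings\<close>

definition set_hop :: "('a \<Rightarrow> 'a \<Rightarrow> 'a set) \<Rightarrow> 'a set \<Rightarrow> 'a set \<Rightarrow> 'a set" where
  "set_hop f A B = (\<Union>a\<in>A. \<Union>b\<in>B. f a b)"

locale semi_hypergroup =
  fixes H :: "'a set" and f :: "'a \<Rightarrow> 'a \<Rightarrow> 'a set"
  assumes nonempty: "H \<noteq> {}"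
    and hop_closed: "x \<in> H \<Longrightarrow> y \<in> H \<Longrightarrow> f x y \<subseteq> H"
    and hop_nonempty: "x \<in> H \<Longrightarrow> y \<in> H \<Longrightarrow> f x y \<noteq> {}"
    and hop_assoc: "x \<in> H \<Longrightarrow> y \<in> H \<Longrightarrow> z \<in> H \<Longrightarrow>
      set_hop f {x} (f y z) = set_hop f (f x y) {z}"

locale hypergroup = semi_hypergroup +
  assumes reproductive_left: "x \<in> H \<Longrightarrow> set_hop f {x} H = H"
    and reproductive_right: "x \<in> H \<Longrightarrow> set_hop f H {x} = H"

record 'a hyperring = "'a partial_object" +
  hadd :: "'a \<Rightarrow> 'a \<Rightarrow> 'a set"
  hmult :: "'a \<Rightarrow> 'a \<Rightarrow> 'a set"

locale hyperring =
  add: hypergroup "carrier R" "hadd R" + mult: semi_hypergroup "carrier R" "hmult R"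
  for R :: "('a, 'b) hyperring_scheme" +
  assumes distrib_left: "x \<in> carrier R \<Longrightarrow> y \<in> carrier R \<Longrightarrow> z \<in> carrier R \<Longrightarrow>
      set_hop (hmult R) {x} (hadd R y z) = set_hop (hadd R) (hmult R x y) (hmult R x z)"
    and distrib_right: "x \<in> carrier R \<Longrightarrow> y \<in> carrier R \<Longrightarrow> z \<in> carrier R \<Longrightarrow>
      set_hop (hmult R) (hadd R x y) {z} = set_hop (hadd R) (hmult R x z) (hmult R y z)"


section \<open>Sums of products\<close>

text \<open>\<open>hop_iter f A n\<close> is the left-nested iterate over \<open>A 1, \<dots>, A n\<close>. It is only meaningful
  for \<open>n \<ge> 1\<close>; there is no empty hyperproduct.\<close>

fun hop_iter :: "('a \<Rightarrow> 'a \<Rightarrow> 'a set) \<Rightarrow> (nat \<Rightarrow> 'a set) \<Rightarrow> nat \<Rightarrow> 'a set" where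
  "hop_iter f A 0 = {}"
| "hop_iter f A (Suc 0) = A 1"
| "hop_iter f A (Suc (Suc n)) = set_hop f (hop_iter f A (Suc n)) (A (Suc (Suc n)))"

definition hprod :: "('a, 'b) hyperring_scheme \<Rightarrow> nat \<Rightarrow> (nat \<Rightarrow> 'a) \<Rightarrow> 'a set" where
  "hprod R k x = hop_iter (hmult R) (\<lambda>j. {x j}) k"

definition hsum :: "('a, 'b) hyperring_scheme \<Rightarrow> nat \<Rightarrow> (nat \<Rightarrow> 'a set) \<Rightarrow> 'a set" where
  "hsum R n A = hop_iter (hadd R) A n"

text \<open>The formal expression \<open>\<Sum>i=1..n. \<Prod>j=1..k i. x i j\<close> is given by the data \<open>n\<close>, \<open>k\<close>, \<open>x\<close>;
  values of \<open>k\<close> and \<open>x\<close> outside the index ranges are irrelevant.\<close>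

definition is_expr :: "('a, 'b) hyperring_scheme \<Rightarrow> nat \<Rightarrow> (nat \<Rightarrow> nat) \<Rightarrow> (nat \<Rightarrow> nat \<Rightarrow> 'a) \<Rightarrow> bool"
  where "is_expr R n k x \<longleftrightarrow>
    n \<ge> 1 \<and> (\<forall>i\<in>{1..n}. k i \<ge> 1 \<and> (\<forall>j\<in>{1..k i}. x i j \<in> carrier R))"

definition sum_prod :: "('a, 'b) hyperring_scheme \<Rightarrow> nat \<Rightarrow> (nat \<Rightarrow> nat) \<Rightarrow> (nat \<Rightarrow> nat \<Rightarrow> 'a) \<Rightarrow> 'a set"
  where "sum_prod R n k x = hsum R n (\<lambda>i. hprod R (k i) (x i))"


section \<open>The relation \<open>\<lambda>\<^sub>e\<close> and its transitive closure\<close>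

definition alpha_plus :: "('a, 'b) hyperring_scheme \<Rightarrow> 'a rel" where
  "alpha_plus R = {(u, v). \<exists>n k x \<sigma>. is_expr R n k x \<and> \<sigma> permutes {1..n} \<and>
     u \<in> sum_prod R n k x \<and> v \<in> hsum R n (\<lambda>i. hprod R (k (\<sigma> i)) (x (\<sigma> i)))}"

text \<open>In the second disjunct \<open>I\<close> is the set \<open>{i\<^sub>1, \<dots>, i\<^sub>d}\<close>. The subtractions on naturals never
  truncate, because \<open>p \<le> l\<close>, and \<open>l < t\<close> where \<open>t + p - l - 1\<close> is used.\<close>

definition P_cond :: "'a \<Rightarrow> nat \<Rightarrow> (nat \<Rightarrow> nat) \<Rightarrow> (nat \<Rightarrow> nat \<Rightarrow> 'a) \<Rightarrow>
    (nat \<Rightarrow> nat) \<Rightarrow> (nat \<Rightarrow> nat \<Rightarrow> 'a) \<Rightarrow> bool" where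
  "P_cond e m k x k' y \<longleftrightarrow>
    (\<forall>i\<in>{1..m}. k i = k' i \<and> (\<forall>j\<in>{1..k i}. x i j = y i j)) \<or>
    (\<exists>I. I \<noteq> {} \<and> I \<subseteq> {1..m} \<and>
      (\<forall>i\<in>{1..m} - I. k i = k' i \<and> (\<forall>t\<in>{1..k' i}. x i t = y i t)) \<and>
      (\<forall>i\<in>I. \<exists>p l. 1 \<le> p \<and> p \<le> l \<and> l \<le> k' i \<and> k' i = k i + (l - p + 1) \<and>
        (\<forall>t. 1 \<le> t \<and> t < p \<longrightarrow> y i t = x i t) \<and>
        (\<forall>t. p \<le> t \<and> t \<le> l \<longrightarrow> y i t = e) \<and>
        (\<forall>t. l < t \<and> t \<le> k' i \<longrightarrow> y i t = x i (t + p - l - 1))))"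

definition Re :: "('a, 'b) hyperring_scheme \<Rightarrow> 'a \<Rightarrow> nat \<Rightarrow> 'a set rel" where
  "Re R e m =
    {(sum_prod R m k x, sum_prod R m k' y) | k x k' y.
       is_expr R m k x \<and> is_expr R m k' y \<and> P_cond e m k x k' y} \<union>
    {(sum_prod R m k' y, sum_prod R m k x) | k x k' y.
       is_expr R m k x \<and> is_expr R m k' y \<and> P_cond e m k x k' y}"

definition lambda_times_m :: "('a, 'b) hyperring_scheme \<Rightarrow> 'a \<Rightarrow> nat \<Rightarrow> 'a rel" where
  "lambda_times_m R e m = {(u, v). \<exists>(A, B) \<in> Re R e m. u \<in> A \<and> v \<in> B}"

definition lambda_times :: "('a, 'b) hyperring_scheme \<Rightarrow> 'a \<Rightarrow> 'a rel" where
  "lambda_times R e = (\<Union>m\<in>{1..}. lambda_times_m R e m)"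

definition lambda_rel :: "('a, 'b) hyperring_scheme \<Rightarrow> 'a \<Rightarrow> 'a rel" where
  "lambda_rel R e = lambda_times R e \<union> alpha_plus R"

definition lambda_star :: "('a, 'b) hyperring_scheme \<Rightarrow> 'a \<Rightarrow> 'a rel" where
  "lambda_star R e = (lambda_rel R e)\<^sup>+"


section \<open>The quotient ring and the set \<open>D\<^sub>e(R)\<close>\<close>

definition phi :: "('a, 'b) hyperring_scheme \<Rightarrow> 'a \<Rightarrow> 'a \<Rightarrow> 'a set" where
  "phi R e a = lambda_star R e `` {a}"

text \<open>The descriptions below are well defined for a hyperring \<open>R\<close> with \<open>e\<close> in its carrier: the
  class of \<open>c\<close> is the same for all \<open>c\<close> in the hypersum (hyperproduct) of two classes.\<close>

definition quot_add :: "('a, 'b) hyperring_scheme \<Rightarrow> 'a \<Rightarrow> 'a set \<Rightarrow> 'a set \<Rightarrow> 'a set" where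
  "quot_add R e X Y = (THE Z. \<exists>c \<in> set_hop (hadd R) X Y. Z = phi R e c)"

definition quot_mult :: "('a, 'b) hyperring_scheme \<Rightarrow> 'a \<Rightarrow> 'a set \<Rightarrow> 'a set \<Rightarrow> 'a set" where
  "quot_mult R e X Y = (THE Z. \<exists>d \<in> set_hop (hmult R) X Y. Z = phi R e d)"

definition lambda_quot :: "('a, 'b) hyperring_scheme \<Rightarrow> 'a \<Rightarrow> 'a set ring" where
  "lambda_quot R e =
    \<lparr>carrier = carrier R // lambda_star R e,
     monoid.mult = quot_mult R e,
     one = phi R e e,
     zero = (THE Z. Z \<in> carrier R // lambda_star R e \<and>
       (\<forall>X \<in> carrier R // lambda_star R e. quot_add R e Z X = X \<and> quot_add R e X Z = X)),
     add = quot_add R e\<rparr>"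

definition phi_preimage :: "('a, 'b) hyperring_scheme \<Rightarrow> 'a \<Rightarrow> 'a set set \<Rightarrow> 'a set" where
  "phi_preimage R e Y = {a \<in> carrier R. phi R e a \<in> Y}"

definition D_set :: "('a, 'b) hyperring_scheme \<Rightarrow> 'a \<Rightarrow> 'a set" where
  "D_set R e = phi_preimage R e {\<one>\<^bsub>lambda_quot R e\<^esub>}"


section \<open>\<open>\<lambda>\<^sub>e\<close>-parts and \<open>\<lambda>\<^sub>e\<close>-strong hyperrings\<close>

text \<open>Only insertion of blocks of \<open>e\<close> is required to preserve a \<open>\<lambda>\<^sub>e\<close>-part, although \<open>\<lambda>\<^sub>e\<close> is
  symmetric.\<close>

definition lambda_part :: "('a, 'b) hyperring_scheme \<Rightarrow> 'a \<Rightarrow> 'a set \<Rightarrow> bool" where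
  "lambda_part R e M \<longleftrightarrow> M \<noteq> {} \<and> M \<subseteq> carrier R \<and>
    (\<forall>n k x \<sigma>. is_expr R n k x \<and> \<sigma> permutes {1..n} \<and> sum_prod R n k x \<inter> M \<noteq> {} \<longrightarrow>
       sum_prod R n (\<lambda>i. k (\<sigma> i)) (\<lambda>i. x (\<sigma> i)) \<subseteq> M) \<and>
    (\<forall>m k x k' y. is_expr R m k x \<and> is_expr R m k' y \<and> P_cond e m k x k' y \<and>
       sum_prod R m k x \<inter> M \<noteq> {} \<longrightarrow> sum_prod R m k' y \<subseteq> M)"

definition lambda_strong :: "('a, 'b) hyperring_scheme \<Rightarrow> 'a \<Rightarrow> bool" where
  "lambda_strong R e \<longleftrightarrow>
    (\<forall>x\<in>carrier R. \<forall>y\<in>carrier R. (x, y) \<in> lambda_star R e \<longrightarrow>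
       hmult R x e \<inter> hmult R y e \<noteq> {} \<and> hmult R e x \<inter> hmult R e y \<noteq> {}) \<and>
    (\<forall>x\<in>carrier R. \<forall>y\<in>carrier R.
       (y \<in> hmult R x e \<longrightarrow> x \<in> hmult R y e) \<and> (y \<in> hmult R e x \<longrightarrow> x \<in> hmult R e y))"

end

theory Submission
  imports Defs
begin

text \<open>In a \<open>\<lambda>\<^sub>e\<close>-strong hyperring the class of an element can be computed with \<open>e\<close> alone: if
  \<open>x\<close> and \<open>y\<close> are equivalent, some \<open>z\<close> lies in both \<open>x \<cdot> e\<close> and \<open>y \<cdot> e\<close>, and invertibility of
  \<open>e\<close> turns \<open>z \<in> y \<cdot> e\<close> into \<open>y \<in> z \<cdot> e\<close>. Hence \<open>y \<in> (x \<cdot> e) \<cdot> e\<close>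
  (\<open>lambda_strong_right\<close>), and likewise \<open>y \<in> e \<cdot> (e \<cdot> x)\<close> (\<open>lambda_strong_left\<close>).
  Conversely, multiplying by \<open>e\<close> on either side stays inside the class
  (\<open>lambda_star_insert_right\<close>, \<open>lambda_star_insert_left\<close>), since this inserts one \<open>e\<close> into a
  product with a single factor.

  For (i), a \<open>y\<close> equivalent to \<open>m \<in> M\<close> lies in \<open>(m \<cdot> e) \<cdot> e = m \<cdot> (e \<cdot> e)\<close>, and
  \<open>e \<cdot> e \<subseteq> D\<^sub>e(R)\<close>. In the other direction \<open>D\<^sub>e(R) \<subseteq> (e \<cdot> e) \<cdot> e\<close>, so by associativity an
  element of \<open>m \<cdot> D\<^sub>e(R)\<close> arises from \<open>m\<close> by three multiplications with \<open>e\<close>.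

  For (ii), closure under \<open>\<lambda>\<^sub>e\<close> always gives a \<open>\<lambda>\<^sub>e\<close>-part. Conversely, (P2) only allows
  insertions of \<open>e\<close>, whereas \<open>\<lambda>\<^sub>e\<close> also deletes them; but the passage from \<open>x\<close> to
  \<open>(x \<cdot> e) \<cdot> e\<close> consists of insertions, and it reaches the whole class of \<open>x\<close>.\<close>

section \<open>Hyperproducts and expressions\<close>

lemma mem_set_hop: "w \<in> set_hop f A B \<longleftrightarrow> (\<exists>a\<in>A. \<exists>b\<in>B. w \<in> f a b)"
  by (auto simp: set_hop_def)

context semi_hypergroup
begin

lemma mem_hop_assoc:
  assumes "x \<in> H" "y \<in> H" "z \<in> H"
  shows "(\<exists>u\<in>f y z. w \<in> f x u) \<longleftrightarrow> (\<exists>u\<in>f x y. w \<in> f u z)"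
  using hop_assoc[OF assms] by (auto simp: set_hop_def)

lemma hop_iter_closed:
  assumes "\<And>i. 1 \<le> i \<Longrightarrow> i \<le> n \<Longrightarrow> A i \<subseteq> H"
  shows "hop_iter f A n \<subseteq> H"
  using assms
proof (induction n)
  case (Suc n)
  then have IH: "hop_iter f A n \<subseteq> H" and A: "A (Suc n) \<subseteq> H"
    by simp_all
  show ?case
  proof (cases n)
    case 0
    with A show ?thesis
      by simp
  next
    case (Suc m)
    have "set_hop f (hop_iter f A n) (A (Suc n)) \<subseteq> H"
      using IH A hop_closed unfolding set_hop_def by blast
    with Suc show ?thesis
      by simp
  qed
qed simp

end

lemma is_expr_permute:
  assumes "is_expr R n k x" "\<sigma> permutes {1..n}"
  shows "is_expr R n (\<lambda>i. k (\<sigma> i)) (\<lambda>i. x (\<sigma> i))"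
  using assms permutes_in_image[OF assms(2)] by (auto simp: is_expr_def)

context hyperring
begin

lemma sum_prod_closed:
  assumes "is_expr R n k x"
  shows "sum_prod R n k x \<subseteq> carrier R"
  unfolding sum_prod_def hsum_def hprod_def
  using assms
  by (intro add.hop_iter_closed mult.hop_iter_closed) (auto simp: is_expr_def)

end

text \<open>The step from \<open>x\<close> to \<open>x \<cdot> e\<close> or \<open>e \<cdot> x\<close> turns a sum with one summand and one factor into
  a sum with one summand and two factors; these are the two shapes of expression involved.\<close>

lemma single_expr:
  assumes "x \<in> carrier R"
  shows "is_expr R 1 (\<lambda>i. 1) (\<lambda>i j. x)" "sum_prod R 1 (\<lambda>i. 1) (\<lambda>i j. x) = {x}"
  using assms by (simp_all add: is_expr_def sum_prod_def hsum_def hprod_def)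

lemma pair_expr:
  assumes "x \<in> carrier R" "y \<in> carrier R"
  shows "is_expr R 1 (\<lambda>i. 2) (\<lambda>i j. if j = 1 then x else y)"
    "sum_prod R 1 (\<lambda>i. 2) (\<lambda>i j. if j = 1 then x else y) = hmult R x y"
  using assms
  by (auto simp: is_expr_def sum_prod_def hsum_def hprod_def numeral_2_eq_2 set_hop_def)

section \<open>The relation as an equivalence\<close>

lemma alpha_plusI:
  assumes "is_expr R n k x" "\<sigma> permutes {1..n}" "u \<in> sum_prod R n k x"
    and "v \<in> sum_prod R n (\<lambda>i. k (\<sigma> i)) (\<lambda>i. x (\<sigma> i))"
  shows "(u, v) \<in> alpha_plus R"
  using assms unfolding alpha_plus_def sum_prod_def by blast

lemma alpha_plusE:
  assumes "(u, v) \<in> alpha_plus R"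
  obtains n k x \<sigma> where "is_expr R n k x" "\<sigma> permutes {1..n}" "u \<in> sum_prod R n k x"
    "v \<in> sum_prod R n (\<lambda>i. k (\<sigma> i)) (\<lambda>i. x (\<sigma> i))"
  using assms unfolding alpha_plus_def sum_prod_def by blast

lemma lambda_times_iff:
  "(u, v) \<in> lambda_times R e \<longleftrightarrow> (\<exists>m k x k' y.
     is_expr R m k x \<and> is_expr R m k' y \<and> P_cond e m k x k' y \<and>
     (u \<in> sum_prod R m k x \<and> v \<in> sum_prod R m k' y \<or>
      v \<in> sum_prod R m k x \<and> u \<in> sum_prod R m k' y))"
  (is "?L \<longleftrightarrow> ?R")
proof
  assume ?L
  then obtain m A B where "(A, B) \<in> Re R e m" and uv: "u \<in> A" "v \<in> B"
    by (auto simp: lambda_times_def lambda_times_m_def)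
  then obtain k x k' y where
    "is_expr R m k x" "is_expr R m k' y" "P_cond e m k x k' y"
    "A = sum_prod R m k x \<and> B = sum_prod R m k' y \<or>
      B = sum_prod R m k x \<and> A = sum_prod R m k' y"
    unfolding Re_def by fastforce
  then show ?R
    using uv by metis
next
  assume ?R
  then obtain m k x k' y where
    *: "is_expr R m k x" "is_expr R m k' y" "P_cond e m k x k' y"
    and **: "u \<in> sum_prod R m k x \<and> v \<in> sum_prod R m k' y \<or>
      v \<in> sum_prod R m k x \<and> u \<in> sum_prod R m k' y"
    by blast
  have "(sum_prod R m k x, sum_prod R m k' y) \<in> Re R e m"
    "(sum_prod R m k' y, sum_prod R m k x) \<in> Re R e m"
    using * unfolding Re_def by blast+
  then have "(u, v) \<in> lambda_times_m R e m"
    using ** unfolding lambda_times_m_def by blast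
  moreover have "1 \<le> m"
    using * by (simp add: is_expr_def)
  ultimately show ?L
    unfolding lambda_times_def by blast
qed

lemma sym_alpha_plus: "sym (alpha_plus R)"
proof (rule symI)
  fix u v
  assume "(u, v) \<in> alpha_plus R"
  then obtain n k x \<sigma> where *: "is_expr R n k x" "\<sigma> permutes {1..n}" "u \<in> sum_prod R n k x"
    "v \<in> sum_prod R n (\<lambda>i. k (\<sigma> i)) (\<lambda>i. x (\<sigma> i))"
    by (rule alpha_plusE)
  have "is_expr R n (\<lambda>i. k (\<sigma> i)) (\<lambda>i. x (\<sigma> i))"
    using * is_expr_permute by blast
  moreover have "Hilbert_Choice.inv \<sigma> permutes {1..n}"
    using * permutes_inv by blast
  ultimately show "(v, u) \<in> alpha_plus R"
    using * by (intro alpha_plusI[where \<sigma> = "Hilbert_Choice.inv \<sigma>"]) (auto simp: permutes_inverses)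
qed

lemma sym_lambda_star: "sym (lambda_star R e)"
proof -
  have "sym (lambda_times R e)"
    by (rule symI) (unfold lambda_times_iff, blast)
  then show ?thesis
    unfolding lambda_star_def lambda_rel_def by (intro sym_trancl sym_Un sym_alpha_plus)
qed

lemma trans_lambda_star: "trans (lambda_star R e)"
  unfolding lambda_star_def by (rule trans_trancl)

lemma phi_eqI:
  assumes "(x, y) \<in> lambda_star R e"
  shows "phi R e x = phi R e y"
proof -
  have "(y, x) \<in> lambda_star R e"
    using assms sym_lambda_star by (rule symD[rotated])
  then show ?thesis
    using assms by (auto simp: phi_def intro: transD[OF trans_lambda_star])
qed

lemma lambda_star_refl:
  assumes "x \<in> carrier R"
  shows "(x, x) \<in> lambda_star R e"
proof -
  have "(x, x) \<in> alpha_plus R"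
    using single_expr[OF assms] permutes_id[of "{1..1::nat}"]
    by (intro alpha_plusI[where n = 1 and \<sigma> = id]) auto
  then show ?thesis
    unfolding lambda_star_def lambda_rel_def by blast
qed

lemma phi_eq_iff:
  assumes "y \<in> carrier R"
  shows "phi R e x = phi R e y \<longleftrightarrow> (x, y) \<in> lambda_star R e"
proof
  assume "phi R e x = phi R e y"
  moreover have "y \<in> phi R e y"
    using lambda_star_refl[OF assms] by (simp add: phi_def)
  ultimately have "y \<in> phi R e x"
    by simp
  then show "(x, y) \<in> lambda_star R e"
    by (simp add: phi_def)
qed (rule phi_eqI)

lemma phi_preimage_phi_image:
  assumes "M \<subseteq> carrier R"
  shows "phi_preimage R e (phi R e ` M) = {y \<in> carrier R. \<exists>m\<in>M. (m, y) \<in> lambda_star R e}"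
  unfolding phi_preimage_def using phi_eq_iff[of _ R e] phi_eqI[of _ _ R e] by blast

lemma D_set_eq:
  assumes "e \<in> carrier R"
  shows "D_set R e = {d \<in> carrier R. (e, d) \<in> lambda_star R e}"
  using phi_preimage_phi_image[of "{e}" R e] assms by (simp add: D_set_def lambda_quot_def)

lemma (in hyperring) lambda_star_closed:
  assumes "(x, y) \<in> lambda_star R e"
  shows "x \<in> carrier R" "y \<in> carrier R"
proof -
  have "lambda_times R e \<subseteq> carrier R \<times> carrier R"
    using sum_prod_closed by (force simp: lambda_times_iff)
  moreover have "alpha_plus R \<subseteq> carrier R \<times> carrier R"
  proof (rule subrelI)
    fix u v
    assume "(u, v) \<in> alpha_plus R"
    then show "(u, v) \<in> carrier R \<times> carrier R"
      by (rule alpha_plusE) (use sum_prod_closed is_expr_permute in blast)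
  qed
  ultimately have "lambda_star R e \<subseteq> carrier R \<times> carrier R"
    unfolding lambda_star_def lambda_rel_def by (intro trancl_subset_Sigma) blast
  then show "x \<in> carrier R" "y \<in> carrier R"
    using assms by auto
qed

section \<open>Multiplication by \<open>e\<close>\<close>

text \<open>The inserted block is the single position 2, respectively 1, of the one product.\<close>

lemma P_cond_insert_right:
  "P_cond e 1 (\<lambda>i. 1) (\<lambda>i j. x) (\<lambda>i. 2) (\<lambda>i j. if j = 1 then x else e)"
  unfolding P_cond_def
  by (rule disjI2, rule exI[of _ "{1}"]) (auto intro!: exI[of _ "2::nat"])

lemma P_cond_insert_left:
  "P_cond e 1 (\<lambda>i. 1) (\<lambda>i j. x) (\<lambda>i. 2) (\<lambda>i j. if j = 1 then e else x)"
  unfolding P_cond_def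
  by (rule disjI2, rule exI[of _ "{1}"]) (auto intro!: exI[of _ "1::nat"])

lemma lambda_star_insert_right:
  assumes "x \<in> carrier R" "e \<in> carrier R" "w \<in> hmult R x e"
  shows "(x, w) \<in> lambda_star R e"
proof -
  have "(x, w) \<in> lambda_times R e"
    using single_expr[of x R] pair_expr[of x R e] P_cond_insert_right[of e x] assms
    unfolding lambda_times_iff by blast
  then show ?thesis
    unfolding lambda_star_def lambda_rel_def by blast
qed

lemma lambda_star_insert_left:
  assumes "x \<in> carrier R" "e \<in> carrier R" "w \<in> hmult R e x"
  shows "(x, w) \<in> lambda_star R e"
proof -
  have "(x, w) \<in> lambda_times R e"
    using single_expr[of x R] pair_expr[of e R x] P_cond_insert_left[of e x] assms
    unfolding lambda_times_iff by blast
  then show ?thesis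
    unfolding lambda_star_def lambda_rel_def by blast
qed

lemma lambda_part_mult_right:
  assumes "lambda_part R e M" "e \<in> carrier R" "x \<in> M"
  shows "hmult R x e \<subseteq> M"
proof -
  have x: "x \<in> carrier R"
    using assms unfolding lambda_part_def by blast
  have P2: "\<forall>m k x k' y. is_expr R m k x \<and> is_expr R m k' y \<and> P_cond e m k x k' y \<and>
       sum_prod R m k x \<inter> M \<noteq> {} \<longrightarrow> sum_prod R m k' y \<subseteq> M"
    using assms(1) unfolding lambda_part_def by (elim conjE)
  have "sum_prod R 1 (\<lambda>i. 2) (\<lambda>i j. if j = 1 then x else e) \<subseteq> M"
    using P2[rule_format, of 1 "\<lambda>i. 1" "\<lambda>i j. x" "\<lambda>i. 2"]
      single_expr[OF x] pair_expr(1)[OF x assms(2)] P_cond_insert_right[of e x] assms(3)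
    by auto
  then show ?thesis
    using pair_expr(2)[OF x assms(2)] by simp
qed

text \<open>The two halves of strength combine: a common element of \<open>x \<cdot> e\<close> and \<open>y \<cdot> e\<close> leads from
  \<open>x\<close> to \<open>y\<close>, because the second membership can be reversed.\<close>

lemma (in hyperring) lambda_strong_right:
  assumes "lambda_strong R e" "e \<in> carrier R" "(x, y) \<in> lambda_star R e"
  obtains z where "z \<in> carrier R" "z \<in> hmult R x e" "y \<in> hmult R z e"
proof -
  have xy: "x \<in> carrier R" "y \<in> carrier R"
    using lambda_star_closed assms(3) by blast+
  then obtain z where "z \<in> hmult R x e" "z \<in> hmult R y e"
    using assms unfolding lambda_strong_def by blast
  moreover from this have "z \<in> carrier R"
    using mult.hop_closed assms(2) xy by blast
  ultimately show ?thesis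
    using that assms(1) xy unfolding lambda_strong_def by blast
qed

lemma (in hyperring) lambda_strong_left:
  assumes "lambda_strong R e" "e \<in> carrier R" "(x, y) \<in> lambda_star R e"
  obtains z where "z \<in> carrier R" "z \<in> hmult R e x" "y \<in> hmult R e z"
proof -
  have xy: "x \<in> carrier R" "y \<in> carrier R"
    using lambda_star_closed assms(3) by blast+
  then obtain z where "z \<in> hmult R e x" "z \<in> hmult R e y"
    using assms unfolding lambda_strong_def by blast
  moreover from this have "z \<in> carrier R"
    using mult.hop_closed assms(2) xy by blast
  ultimately show ?thesis
    using that assms(1) xy unfolding lambda_strong_def by blast
qed

section \<open>Products with \<open>D\<^sub>e(R)\<close>\<close>

context hyperring
begin

lemma e_hop_e_subset_D_set:
  assumes "e \<in> carrier R"
  shows "hmult R e e \<subseteq> D_set R e"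
  using assms mult.hop_closed lambda_star_insert_right by (fastforce simp: D_set_eq)

text \<open>Write \<open>d \<in> z \<cdot> e\<close> with \<open>z \<in> e \<cdot> e\<close>; reassociating \<open>m \<cdot> d\<close> exposes one factor \<open>e\<close> on
  the right at a time.\<close>

lemma mult_D_set_right:
  assumes "lambda_strong R e" "e \<in> carrier R" "m \<in> carrier R" "d \<in> D_set R e"
    and "v \<in> hmult R m d"
  shows "(m, v) \<in> lambda_star R e"
proof -
  have "(e, d) \<in> lambda_star R e"
    using assms by (simp add: D_set_eq)
  then obtain z where z: "z \<in> carrier R" "z \<in> hmult R e e" "d \<in> hmult R z e"
    using lambda_strong_right assms by blast
  obtain w where w: "w \<in> hmult R m z" "v \<in> hmult R w e"
    using mult.mem_hop_assoc[of m z e v] z assms by blast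
  obtain w' where w': "w' \<in> hmult R m e" "w \<in> hmult R w' e"
    using mult.mem_hop_assoc[of m e e w] z w assms by blast
  have carr: "w \<in> carrier R" "w' \<in> carrier R"
    using mult.hop_closed w(1) w'(1) z assms by blast+
  have "(m, w') \<in> lambda_star R e" "(w', w) \<in> lambda_star R e" "(w, v) \<in> lambda_star R e"
    using lambda_star_insert_right[OF _ assms(2)] w(2) w' carr assms(3) by simp_all
  then show ?thesis
    using trans_lambda_star by (meson transD)
qed

lemma mult_D_set_left:
  assumes "lambda_strong R e" "e \<in> carrier R" "m \<in> carrier R" "d \<in> D_set R e"
    and "v \<in> hmult R d m"
  shows "(m, v) \<in> lambda_star R e"
proof -
  have "(e, d) \<in> lambda_star R e"
    using assms by (simp add: D_set_eq)
  then obtain z where z: "z \<in> carrier R" "z \<in> hmult R e e" "d \<in> hmult R e z"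
    using lambda_strong_left assms by blast
  obtain w where w: "w \<in> hmult R z m" "v \<in> hmult R e w"
    using mult.mem_hop_assoc[of e z m v] z assms by blast
  obtain w' where w': "w' \<in> hmult R e m" "w \<in> hmult R e w'"
    using mult.mem_hop_assoc[of e e m w] z w assms by blast
  have carr: "w \<in> carrier R" "w' \<in> carrier R"
    using mult.hop_closed w(1) w'(1) z assms by blast+
  have "(m, w') \<in> lambda_star R e" "(w', w) \<in> lambda_star R e" "(w, v) \<in> lambda_star R e"
    using lambda_star_insert_left[OF _ assms(2)] w(2) w' carr assms(3) by simp_all
  then show ?thesis
    using trans_lambda_star by (meson transD)
qed

lemma set_hop_D_set_right:
  assumes "lambda_strong R e" "e \<in> carrier R" "M \<subseteq> carrier R"
  shows "set_hop (hmult R) M (D_set R e) = phi_preimage R e (phi R e ` M)"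
proof (rule Set.set_eqI, rule iffI)
  fix v
  assume "v \<in> set_hop (hmult R) M (D_set R e)"
  then obtain m d where "m \<in> M" "d \<in> D_set R e" "v \<in> hmult R m d"
    by (auto simp: mem_set_hop)
  then have "(m, v) \<in> lambda_star R e"
    using mult_D_set_right assms by blast
  then show "v \<in> phi_preimage R e (phi R e ` M)"
    using \<open>m \<in> M\<close> lambda_star_closed assms by (auto simp: phi_preimage_phi_image)
next
  fix v
  assume "v \<in> phi_preimage R e (phi R e ` M)"
  then obtain m where m: "m \<in> M" "(m, v) \<in> lambda_star R e"
    using assms by (auto simp: phi_preimage_phi_image)
  then obtain z where "z \<in> hmult R m e" "v \<in> hmult R z e"
    using lambda_strong_right assms by blast
  then obtain d where "d \<in> hmult R e e" "v \<in> hmult R m d"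
    using mult.mem_hop_assoc[of m e e v] m assms by blast
  then show "v \<in> set_hop (hmult R) M (D_set R e)"
    using e_hop_e_subset_D_set m assms by (auto simp: mem_set_hop)
qed

lemma set_hop_D_set_left:
  assumes "lambda_strong R e" "e \<in> carrier R" "M \<subseteq> carrier R"
  shows "set_hop (hmult R) (D_set R e) M = phi_preimage R e (phi R e ` M)"
proof (rule Set.set_eqI, rule iffI)
  fix v
  assume "v \<in> set_hop (hmult R) (D_set R e) M"
  then obtain m d where "m \<in> M" "d \<in> D_set R e" "v \<in> hmult R d m"
    by (auto simp: mem_set_hop)
  then have "(m, v) \<in> lambda_star R e"
    using mult_D_set_left assms by blast
  then show "v \<in> phi_preimage R e (phi R e ` M)"
    using \<open>m \<in> M\<close> lambda_star_closed assms by (auto simp: phi_preimage_phi_image)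
next
  fix v
  assume "v \<in> phi_preimage R e (phi R e ` M)"
  then obtain m where m: "m \<in> M" "(m, v) \<in> lambda_star R e"
    using assms by (auto simp: phi_preimage_phi_image)
  then obtain z where "z \<in> hmult R e m" "v \<in> hmult R e z"
    using lambda_strong_left assms by blast
  then obtain d where "d \<in> hmult R e e" "v \<in> hmult R d m"
    using mult.mem_hop_assoc[of e e m v] m assms by blast
  then show "v \<in> set_hop (hmult R) (D_set R e) M"
    using e_hop_e_subset_D_set m assms by (auto simp: mem_set_hop)
qed

section \<open>Saturated sets\<close>

lemma saturated_iff:
  assumes "M \<subseteq> carrier R"
  shows "phi_preimage R e (phi R e ` M) = M \<longleftrightarrow>
    (\<forall>x y. x \<in> M \<longrightarrow> (x, y) \<in> lambda_star R e \<longrightarrow> y \<in> M)"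
  using assms lambda_star_closed(2) lambda_star_refl[of _ R e]
  unfolding phi_preimage_phi_image[OF assms] by blast

text \<open>The element \<open>y\<close> is reached from \<open>x\<close> by two insertions of \<open>e\<close>, also when \<open>x\<close> and \<open>y\<close> are
  related by deleting factors \<open>e\<close> or by permuting summands.\<close>

lemma lambda_part_saturated:
  assumes "lambda_strong R e" "e \<in> carrier R" "lambda_part R e M"
    and "x \<in> M" "(x, y) \<in> lambda_star R e"
  shows "y \<in> M"
proof -
  obtain z where z: "z \<in> hmult R x e" "y \<in> hmult R z e"
    using lambda_strong_right[OF assms(1,2,5)] by metis
  have "z \<in> M"
    using lambda_part_mult_right[OF assms(3,2,4)] z(1) by (rule subsetD)
  then show ?thesis
    using lambda_part_mult_right[OF assms(3,2)] z(2) by (blast dest: subsetD)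
qed

lemma saturated_lambda_part:
  assumes "M \<noteq> {}" "M \<subseteq> carrier R"
    and sat: "\<And>x y. x \<in> M \<Longrightarrow> (x, y) \<in> lambda_star R e \<Longrightarrow> y \<in> M"
  shows "lambda_part R e M"
  unfolding lambda_part_def
proof (intro conjI allI impI subsetI)
  fix n k x \<sigma> v
  assume *: "is_expr R n k x \<and> \<sigma> permutes {1..n} \<and> sum_prod R n k x \<inter> M \<noteq> {}"
    and v: "v \<in> sum_prod R n (\<lambda>i. k (\<sigma> i)) (\<lambda>i. x (\<sigma> i))"
  from * obtain u where u: "u \<in> sum_prod R n k x" "u \<in> M"
    by blast
  with * v have "(u, v) \<in> alpha_plus R"
    by (blast intro: alpha_plusI)
  then show "v \<in> M"
    using sat[OF u(2)] unfolding lambda_star_def lambda_rel_def by blast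
next
  fix m k x k' y v
  assume *: "is_expr R m k x \<and> is_expr R m k' y \<and> P_cond e m k x k' y \<and>
      sum_prod R m k x \<inter> M \<noteq> {}"
    and v: "v \<in> sum_prod R m k' y"
  from * obtain u where u: "u \<in> sum_prod R m k x" "u \<in> M"
    by blast
  with * v have "(u, v) \<in> lambda_times R e"
    unfolding lambda_times_iff by blast
  then show "v \<in> M"
    using sat[OF u(2)] unfolding lambda_star_def lambda_rel_def by blast
qed (use assms in auto)

end

theorem proposition4p4:
  fixes R :: "('a, 'b) hyperring_scheme" and e :: 'a and M :: "'a set"
  assumes "hyperring R" and "e \<in> carrier R" and "lambda_strong R e"
    and "M \<subseteq> carrier R" and "M \<noteq> {}"
  shows "(set_hop (hmult R) M (D_set R e) = set_hop (hmult R) (D_set R e) M \<and>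
          set_hop (hmult R) (D_set R e) M = phi_preimage R e (phi R e ` M)) \<and>
         (lambda_part R e M \<longleftrightarrow> phi_preimage R e (phi R e ` M) = M)"
proof -
  interpret hyperring R
    by fact
  have "lambda_part R e M \<longleftrightarrow> (\<forall>x y. x \<in> M \<longrightarrow> (x, y) \<in> lambda_star R e \<longrightarrow> y \<in> M)"
    using lambda_part_saturated[OF assms(3,2)] saturated_lambda_part[OF assms(5,4)] by blast
  then show ?thesis
    using set_hop_D_set_right[OF assms(3,2,4)] set_hop_D_set_left[OF assms(3,2,4)]
      saturated_iff[OF assms(4)] by simp
qed

end
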